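(* For every integer $d \ge 2$ there exists a compact set $K \subseteq [0,1]^d$ such that $K$ intersects each $(d-1)$-dimensional affine subspace of $\mathbb{R}^d$ that meets $[0,1]^d$, but the $d$-fold sumset $dK$ is nowhere dense in $\mathbb{R}^d$.
   Context: For $K\subseteq\mathbb{R}^d$ the $d$-fold sumset is $dK = \{x_1+\dots+x_d : x_1,\dots,x_d\in K\}$ (not the dilate of $K$ by $d$). *)

theory Defs
  imports "HOL-Analysis.Analysis"
begin

definition sumset :: "nat \<Rightarrow> 'a::comm_monoid_add set \<Rightarrow> 'a set" where
  "sumset n K = {\<Sum>i<n. x i | x. \<forall>i<n. x i \<in> K}"

definition nowhere_dense :: "'a::topological_space set \<Rightarrow> bool" where
  "nowhere_dense S \<longleftrightarrow> interior (closure S) = {}"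

lemma sumset_eq_sum_set: "sumset n K = (\<Sum>i<n. K)"
  by (auto simp: sumset_def set_sum_alt)

(* The constant 1 of type real ^ 'd is the all-ones vector, so cbox 0 1 is the unit cube. *)
lemma mem_unit_cube: "x \<in> cbox 0 (1 :: real ^ 'd) \<longleftrightarrow> (\<forall>i. x $ i \<in> {0..1})"
  by (simp add: mem_box_cart)

end

theory Submission
  imports Defs "HOL-Computational_Algebra.Polynomial"
begin

text \<open>
  Fix finitely many directions in general position, so that every nonzero normal vector is
  orthogonal to fewer than \<open>d\<close> of them. Sort the normals into finitely many classes according to
  their signs and to the directions to which they are uniformly transversal; each class omits
  fewer than \<open>d\<close> of the \<open>d\<^sup>2\<close> directions, so any \<open>d\<close> classes have a common direction \<open>\<sigma>\<close>.
  For each class \<open>i\<close> a decreasing sequence of finite unions of cubes is built that keeps meeting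
  every hyperplane of class \<open>i\<close> that meets the unit cube. Given \<open>d\<close> classes, their cubes can be
  replaced by much smaller ones lying near finitely many segments parallel to the common \<open>\<sigma>\<close>
  (up to accumulation at corners), so that the sum of the \<open>d\<close> unions lies close to a countable union
  of parallel lines and misses a point of any prescribed ball. Doing this for all \<open>d\<close>-tuples of classes
  and all basic open sets, the union of the limit sets is \<open>K\<close>.
\<close>

subsection \<open>Cubes and shadows\<close>

text \<open>The norm dual to the sup norm: \<open>r * l1 a\<close> is the largest value of
  \<open>\<bar>a \<bullet> (x - c)\<bar>\<close> over \<open>x\<close> in \<open>cube c r\<close>,
  for \<open>0 \<le> r\<close>.\<close>

definition l1 :: "real ^ 'd::finite \<Rightarrow> real" where "l1 a = (\<Sum>j\<in>UNIV. \<bar>a $ j\<bar>)"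

definition cube :: "real ^ 'd::finite \<Rightarrow> real \<Rightarrow> (real ^ 'd) set" where
  "cube c r = {x. \<forall>j. \<bar>x $ j - c $ j\<bar> \<le> r}"

text \<open>Geometrically: every hyperplane with normal in \<open>N\<close> that meets
  \<open>D\<close> also meets \<open>E\<close>.\<close>

definition shadow_subset :: "(real ^ 'd::finite) set \<Rightarrow> (real ^ 'd) set \<Rightarrow> (real ^ 'd) set \<Rightarrow> bool" where
  "shadow_subset N D E \<longleftrightarrow> (\<forall>a\<in>N. \<forall>x\<in>D. \<exists>y\<in>E. a \<bullet> y = a \<bullet> x)"

definition tube :: "real \<Rightarrow> 'a::real_normed_vector set \<Rightarrow> 'a \<Rightarrow> 'a set" where
  "tube \<epsilon> F \<sigma> = {x. \<exists>f\<in>F. \<exists>u. dist x (f + u *\<^sub>R \<sigma>) < \<epsilon>}"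

lemma l1_pos: "a \<noteq> 0 \<Longrightarrow> 0 < l1 a"
  using norm_le_l1_cart[of a] by (simp add: l1_def flip: zero_less_norm_iff)

lemma abs_inner_le_l1:
  fixes a x :: "real ^ 'd::finite"
  assumes "\<And>j. \<bar>x $ j\<bar> \<le> r"
  shows "\<bar>a \<bullet> x\<bar> \<le> r * l1 a"
proof -
  have "\<bar>a \<bullet> x\<bar> \<le> (\<Sum>j\<in>UNIV. \<bar>a $ j * x $ j\<bar>)"
    unfolding inner_vec_def by (simp add: sum_abs)
  also have "\<dots> \<le> (\<Sum>j\<in>UNIV. r * \<bar>a $ j\<bar>)"
    by (intro sum_mono) (use assms in \<open>simp add: abs_mult mult.commute[of r] mult_left_mono\<close>)
  finally show ?thesis by (simp add: l1_def sum_distrib_left)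
qed

text \<open>Moving from the centre along the sign vector of \<open>a\<close> changes the inner
  product at rate \<open>l1 a\<close>, so the bound of \<open>abs_inner_le_l1\<close> is attained.
  Whether a hyperplane meets a cube thus becomes an estimate at the centre.\<close>

lemma inner_range_cube:
  fixes a c :: "real ^ 'd::finite"
  assumes "\<bar>t - a \<bullet> c\<bar> \<le> r * l1 a" "0 \<le> r"
  shows "\<exists>x\<in>cube c r. a \<bullet> x = t"
proof (cases "l1 a = 0")
  case True
  then show ?thesis using assms by (intro bexI[of _ c]) (auto simp: cube_def)
next
  case False
  define q where "q = (t - a \<bullet> c) / l1 a"
  define x where "x = c + (\<chi> j. q * sgn (a $ j))"
  have pos: "l1 a > 0" using False l1_pos[of a] by (force simp: l1_def)
  have q: "\<bar>q\<bar> \<le> r" using assms pos by (simp add: q_def field_simps)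
  have "x \<in> cube c r"
    using q assms(2) by (auto simp: cube_def x_def abs_mult sgn_real_def)
  moreover have "a \<bullet> x = a \<bullet> c + q * l1 a"
    by (simp add: x_def inner_add_right inner_vec_def l1_def sum_distrib_left abs_sgn algebra_simps sum.distrib)
  ultimately show ?thesis using pos by (intro bexI[of _ x]) (simp_all add: q_def)
qed

lemma dist_le_coord:
  fixes x y :: "real ^ 'd::finite" and r :: real
  assumes "\<And>j. \<bar>x $ j - y $ j\<bar> \<le> (r::real)"
  shows "dist x y \<le> CARD('d) * r"
proof -
  have "dist x y \<le> (\<Sum>j\<in>UNIV. \<bar>(x - y) $ j\<bar>)"
    unfolding dist_norm by (rule norm_le_l1_cart)
  also have "\<dots> \<le> (\<Sum>j\<in>(UNIV::'d set). r)" using assms by (intro sum_mono) simp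
  finally show ?thesis by simp
qed

lemma cube_eq_cbox: "cube c r = cbox (c - r *\<^sub>R 1) (c + r *\<^sub>R 1)"
  by (auto simp: cube_def mem_box_cart abs_le_iff algebra_simps)

lemma compact_cube: "compact (cube c r)"
  by (simp add: cube_eq_cbox)

section \<open>Finite unions of cubes and the refinement of one cube\<close>

definition cubes :: "((real ^ 'd::finite) \<times> real) set \<Rightarrow> (real ^ 'd) set" where
  "cubes C = (\<Union>(c, r)\<in>C. cube c r)"

definition valid :: "((real ^ 'd::finite) \<times> real) set \<Rightarrow> bool" where
  "valid C \<longleftrightarrow> finite C \<and> (\<forall>(c, r)\<in>C. 0 < r)"

text \<open>Rounding to the nearest multiple could overshoot the end of a segment; rounding toward
  zero keeps the grid point on it.\<close>

lemma round_toward_zero: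
  fixes u r :: real
  assumes "0 < r"
  shows "\<exists>j::int. \<bar>j * r\<bar> \<le> \<bar>u\<bar> \<and> \<bar>u - j * r\<bar> \<le> r"
proof -
  define j where "j = \<lfloor>\<bar>u\<bar> / r\<rfloor>"
  have "of_int j \<le> \<bar>u\<bar> / r" "\<bar>u\<bar> / r < of_int j + 1" "0 \<le> j"
    using assms by (simp_all add: j_def)
  then have j: "j * r \<le> \<bar>u\<bar>" "\<bar>u\<bar> \<le> j * r + r" "0 \<le> j * r"
    using assms by (simp_all add: field_simps)
  show ?thesis
  proof (cases "0 \<le> u")
    case True
    then show ?thesis using j by (intro exI[of _ j]) auto
  next
    case False
    then show ?thesis using j by (intro exI[of _ "- j"]) auto
  qed
qed

text \<open>
  Segments parallel to \<open>\<sigma>\<close> are placed at the points of the main diagonal at relative distance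
  \<open>q ^ k\<close> from its ends, with length proportional to \<open>q ^ k\<close> so that they stay inside the cube. As
  \<open>1 - q = \<delta> / 2\<close>, transversality makes the values of \<open>a \<bullet> x\<close> on consecutive segments overlap; tiny
  corner cubes cover what remains near the ends. The set \<open>F\<close> must not depend on \<open>\<epsilon>\<close>, hence
  the whole sequence of segment centres, together with the corners as limit points.
\<close>
lemma refine_cube:
  fixes c s \<sigma> :: "real ^ 'd::finite"
  assumes s: "\<And>j. \<bar>s $ j\<bar> \<le> 1" and \<sigma>: "\<And>j. \<bar>\<sigma> $ j\<bar> \<le> 1"
    and \<delta>: "0 < \<delta>" "\<delta> \<le> 1" and R: "0 < R"
    and N: "\<And>a. a \<in> N \<Longrightarrow> a \<noteq> 0 \<and> a \<bullet> s = l1 a \<and> \<delta> * l1 a \<le> \<bar>a \<bullet> \<sigma>\<bar>"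
  shows "\<exists>F. countable F \<and> compact F \<and> (\<forall>\<epsilon>>0. \<exists>C. valid C \<and> cubes C \<subseteq> cube c R \<and>
    cubes C \<subseteq> tube \<epsilon> F \<sigma> \<and> shadow_subset N (cube c R) (cubes C))"
proof -
  define q where "q = 1 - \<delta> / 2"
  have q: "0 < q" "q < 1" using \<delta> by (auto simp: q_def)
  define X where "X e k = c + (e * R * (1 - q ^ k)) *\<^sub>R s" for e k
  define Y where "Y e = c + (e * R) *\<^sub>R s" for e
  have qpow: "0 < q ^ k" "q ^ k \<le> 1" for k
    using q by (auto intro: power_le_one)
  have X_lim: "X e \<longlonglongrightarrow> Y e" for e
  proof -
    have "(\<lambda>k. q ^ k) \<longlonglongrightarrow> 0"
      using q by (intro LIMSEQ_realpow_zero) auto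
    then have "X e \<longlonglongrightarrow> c + (e * R * (1 - 0)) *\<^sub>R s"
      using q unfolding X_def by (intro tendsto_intros) auto
    then show ?thesis by (simp add: Y_def)
  qed
  define F where "F = (\<Union>e\<in>{1, -1}. insert (Y e) (range (X e)))"
  show ?thesis
  proof (intro exI[of _ F] conjI allI impI)
    show "countable F" by (auto simp: F_def)
    show "compact F" unfolding F_def
      by (intro compact_UN compact_sequence_with_limit X_lim) auto
    fix \<epsilon> :: real assume "0 < \<epsilon>"
    \<comment> \<open>\<open>CARD('d)\<close> turns coordinate bounds into distances. The 2 serves
      the corner cubes, measured from \<open>Y e\<close>: one \<open>R * q ^ m\<close> is their
      radius, the other bounds the gap between \<open>X e m\<close> and \<open>Y e\<close>.\<close>
    have "\<exists>m. q ^ m < \<epsilon> / (2 * R * CARD('d))"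
      using \<open>0 < \<epsilon>\<close> q R by (intro real_arch_pow_inv) auto
    then obtain m where "q ^ m < \<epsilon> / (2 * R * CARD('d))" ..
    then have m: "CARD('d) * (2 * (R * q ^ m)) < \<epsilon>"
      using R by (simp add: field_simps)
    \<comment> \<open>The slack \<open>R * q ^ k\<close> is shared equally: one half for the
      displacement along \<open>\<sigma>\<close>, the other for the radius \<open>R * r\<close>,
      which fits because \<open>q ^ m \<le> q ^ k\<close>.\<close>
    define r where "r = q ^ m / 2"
    have r: "0 < r" "r \<le> 1" using qpow[of m] by (auto simp: r_def)
    define M where "M = \<lceil>1 / r\<rceil>"
    define C1 where "C1 = {(X e k + (R * (of_int j * r)) *\<^sub>R \<sigma>, R * r) | e k j.
      e \<in> {1, -1} \<and> k < m \<and> \<bar>of_int j * r\<bar> \<le> q ^ k / 2}"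
    define C2 where "C2 = (\<lambda>e. (X e m, R * q ^ m)) ` {1, -1}"
    have "finite C1"
    proof (rule finite_subset)
      have "j \<in> {-M..M}" if "\<bar>of_int j * r\<bar> \<le> q ^ k / 2" for j k
      proof -
        have "\<bar>of_int j\<bar> * r \<le> 1" using that qpow[of k] r by (simp add: abs_mult)
        then have "\<bar>of_int j\<bar> \<le> 1 / r" using r by (simp add: field_simps)
        then have "of_int \<bar>j\<bar> \<le> 1 / r" by simp
        then have "\<bar>j\<bar> \<le> M" unfolding M_def by linarith
        then show ?thesis by auto
      qed
      then show "C1 \<subseteq> (\<lambda>(e, k, j). (X e k + (R * (of_int j * r)) *\<^sub>R \<sigma>, R * r)) `
          ({1, -1} \<times> {..<m} \<times> {-M..M})"
        unfolding C1_def by force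
    qed simp
    show "\<exists>C. valid C \<and> cubes C \<subseteq> cube c R \<and>
       cubes C \<subseteq> tube \<epsilon> F \<sigma> \<and> shadow_subset N (cube c R) (cubes C)"
    proof (intro exI conjI)
      show "valid (C1 \<union> C2)"
        using \<open>finite C1\<close> R r qpow by (auto simp: valid_def C1_def C2_def)
      have "cube c' r' \<subseteq> cube c R \<and> cube c' r' \<subseteq> tube \<epsilon> F \<sigma>" if "(c', r') \<in> C1 \<union> C2" for c' r'
        using that
      proof
        assume "(c', r') \<in> C1"
        then obtain e k j where ekj: "r' = R * r" "e \<in> {1, -1}" "k < m"
          "\<bar>of_int j * r\<bar> \<le> q ^ k / 2" and c': "c' = X e k + (R * (of_int j * r)) *\<^sub>R \<sigma>"
          unfolding C1_def by blast
        have "q ^ m \<le> q ^ k" using ekj q by (intro power_decreasing) auto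
        have "cube c' r' \<subseteq> cube c R"
        proof
          fix x assume x: "x \<in> cube c' r'"
          have "\<bar>x $ i - c $ i\<bar> \<le> R" for i
          proof -
            have 1: "\<bar>x $ i - c' $ i\<bar> \<le> R * (q ^ k / 2)"
              using x ekj \<open>q ^ m \<le> q ^ k\<close> R
              by (auto simp: cube_def r_def intro: order_trans)
            have 2: "\<bar>(R * (of_int j * r)) * \<sigma> $ i\<bar> \<le> R * (q ^ k / 2)"
            proof -
              have "\<bar>of_int j * r\<bar> * \<bar>\<sigma> $ i\<bar> \<le> (q ^ k / 2) * 1"
                using ekj \<sigma>[of i] by (intro mult_mono) auto
              then show ?thesis using R by (simp add: abs_mult mult.assoc)
            qed
            have 3: "\<bar>(e * R * (1 - q ^ k)) * s $ i\<bar> \<le> R * (1 - q ^ k)"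
            proof -
              have "(R * (1 - q ^ k)) * \<bar>s $ i\<bar> \<le> (R * (1 - q ^ k)) * 1"
                using s[of i] R qpow[of k] by (intro mult_left_mono) auto
              then show ?thesis using R ekj qpow[of k] by (auto simp: abs_mult)
            qed
            have "x $ i - c $ i = (x $ i - c' $ i) + (R * (of_int j * r)) * \<sigma> $ i
                + (e * R * (1 - q ^ k)) * s $ i"
              by (simp add: c' X_def)
            then have "\<bar>x $ i - c $ i\<bar> \<le> R * (q ^ k / 2) + R * (q ^ k / 2) + R * (1 - q ^ k)"
              using 1 2 3 by linarith
            then show ?thesis by (simp add: algebra_simps)
          qed
          then show "x \<in> cube c R" by (simp add: cube_def)
        qed
        moreover have "cube c' r' \<subseteq> tube \<epsilon> F \<sigma>"
        proof
          fix x assume x: "x \<in> cube c' r'"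
          then have "dist x c' \<le> CARD('d) * r'" by (intro dist_le_coord) (auto simp: cube_def)
          also have "\<dots> \<le> CARD('d) * (2 * (R * q ^ m))"
            using R qpow[of m] by (intro mult_left_mono) (auto simp: ekj r_def)
          also note m
          finally show "x \<in> tube \<epsilon> F \<sigma>"
            using \<open>e \<in> _\<close> by (auto simp: tube_def F_def c')
        qed
        ultimately show ?thesis ..
      next
        assume "(c', r') \<in> C2"
        then obtain e where e: "e \<in> {1, -1}" "c' = X e m" "r' = R * q ^ m"
          by (auto simp: C2_def)
        have "cube c' r' \<subseteq> cube c R"
        proof
          fix x assume x: "x \<in> cube c' r'"
          have "\<bar>x $ i - c $ i\<bar> \<le> R" for i
          proof -
            have "(R * (1 - q ^ m)) * \<bar>s $ i\<bar> \<le> (R * (1 - q ^ m)) * 1"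
              using s[of i] R qpow[of m] by (intro mult_left_mono) auto
            then have "\<bar>(e * R * (1 - q ^ m)) * s $ i\<bar> \<le> R * (1 - q ^ m)"
              using R e qpow[of m] by (auto simp: abs_mult)
            moreover have "\<bar>x $ i - c' $ i\<bar> \<le> R * q ^ m" using x e by (auto simp: cube_def)
            moreover have "x $ i - c $ i = (x $ i - c' $ i) + (e * R * (1 - q ^ m)) * s $ i"
              by (simp add: e X_def)
            ultimately have "\<bar>x $ i - c $ i\<bar> \<le> R * q ^ m + R * (1 - q ^ m)" by linarith
            then show ?thesis by (simp add: algebra_simps)
          qed
          then show "x \<in> cube c R" by (simp add: cube_def)
        qed
        moreover have "cube c' r' \<subseteq> tube \<epsilon> F \<sigma>"
        proof
          fix x assume x: "x \<in> cube c' r'"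
          have "dist x (Y e) \<le> CARD('d) * (2 * (R * q ^ m))"
          proof (rule dist_le_coord)
            fix i
            have "(R * q ^ m) * \<bar>s $ i\<bar> \<le> (R * q ^ m) * 1"
              using s[of i] R qpow[of m] by (intro mult_left_mono) auto
            then have "\<bar>(e * (R * q ^ m)) * s $ i\<bar> \<le> R * q ^ m"
              using R e qpow[of m] by (auto simp: abs_mult)
            moreover have "\<bar>x $ i - c' $ i\<bar> \<le> R * q ^ m" using x e by (auto simp: cube_def)
            moreover have "x $ i - Y e $ i = (x $ i - c' $ i) - (e * (R * q ^ m)) * s $ i"
              by (simp add: e X_def Y_def algebra_simps)
            ultimately show "\<bar>x $ i - Y e $ i\<bar> \<le> 2 * (R * q ^ m)" by linarith
          qed
          also note m
          finally have "dist x (Y e + 0 *\<^sub>R \<sigma>) < \<epsilon>" by simp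
          moreover have "Y e \<in> F" using e by (auto simp: F_def)
          ultimately show "x \<in> tube \<epsilon> F \<sigma>" unfolding tube_def by blast
        qed
        ultimately show ?thesis ..
      qed
      then show "cubes (C1 \<union> C2) \<subseteq> cube c R" "cubes (C1 \<union> C2) \<subseteq> tube \<epsilon> F \<sigma>"
        unfolding cubes_def by blast+
      show "shadow_subset N (cube c R) (cubes (C1 \<union> C2))"
        unfolding shadow_subset_def
      proof (intro ballI)
        fix a x assume "a \<in> N" and x: "x \<in> cube c R"
        then have a: "a \<noteq> 0" "a \<bullet> s = l1 a" "\<delta> * l1 a \<le> \<bar>a \<bullet> \<sigma>\<bar>" using N by auto
        have L: "0 < l1 a" using a(1) by (rule l1_pos)
        have a\<sigma>: "\<bar>a \<bullet> \<sigma>\<bar> \<le> l1 a" using abs_inner_le_l1[of \<sigma> 1 a] \<sigma> by simp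
        \<comment> \<open>Normalised position of the value of \<open>a\<close>: the centre
          \<open>c\<close> is at 0 and \<open>X e k\<close> at
          \<open>e * (1 - q ^ k)\<close>.\<close>
        define \<tau> where "\<tau> = (a \<bullet> (x - c)) / (R * l1 a)"
        have ax: "a \<bullet> x = a \<bullet> c + \<tau> * R * l1 a"
          using R L by (simp add: \<tau>_def inner_diff_right)
        have "\<bar>a \<bullet> (x - c)\<bar> \<le> R * l1 a"
          using x by (intro abs_inner_le_l1) (auto simp: cube_def)
        then have \<tau>: "\<bar>\<tau>\<bar> \<le> 1" using R L by (simp add: \<tau>_def field_simps)
        define e :: real where "e = (if 0 \<le> \<tau> then 1 else -1)"
        have e: "e \<in> {1, -1}" "\<tau> = e * \<bar>\<tau>\<bar>" "\<bar>e\<bar> = 1" by (auto simp: e_def)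
        have aX: "a \<bullet> X e k = a \<bullet> c + e * (1 - q ^ k) * R * l1 a" for k
          by (simp add: X_def inner_add_right a mult.assoc)
        \<comment> \<open>By \<open>inner_range_cube\<close> it is enough that the value at some
          centre is close enough. Positions beyond \<open>1 - q ^ m\<close> fall to a corner cube,
          the others to a cube on a segment.\<close>
        have "\<exists>c' r'. (c', r') \<in> C1 \<union> C2 \<and> 0 \<le> r' \<and> \<bar>a \<bullet> x - a \<bullet> c'\<bar> \<le> r' * l1 a"
        proof (cases "1 - q ^ m \<le> \<bar>\<tau>\<bar>")
          case True
          have "a \<bullet> x - a \<bullet> X e m = e * (\<bar>\<tau>\<bar> - (1 - q ^ m)) * (R * l1 a)"
            unfolding aX ax by (subst e(2)) (simp add: algebra_simps)
          then have "\<bar>a \<bullet> x - a \<bullet> X e m\<bar> = (\<bar>\<tau>\<bar> - (1 - q ^ m)) * (R * l1 a)"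
            using R L e(3) True by (simp add: abs_mult)
          also have "\<dots> \<le> q ^ m * (R * l1 a)"
            using R L \<tau> by (intro mult_right_mono) auto
          finally show ?thesis using e(1) R qpow[of m]
            by (intro exI[of _ "X e m"] exI[of _ "R * q ^ m"]) (auto simp: C2_def mult_ac)
        next
          case False
          \<comment> \<open>The first \<open>n\<close> with \<open>1 - q ^ n\<close> beyond
            \<open>\<bar>\<tau>\<bar>\<close> is positive because \<open>q ^ 0 = 1\<close>. Its
            predecessor \<open>k\<close> is below \<open>m\<close> and brackets
            \<open>\<bar>\<tau>\<bar>\<close> from below.\<close>
          define n where "n = (LEAST n. \<bar>\<tau>\<bar> < 1 - q ^ n)"
          have n: "\<bar>\<tau>\<bar> < 1 - q ^ n" "n \<le> m"
            using False LeastI[of "\<lambda>n. \<bar>\<tau>\<bar> < 1 - q ^ n" m] Least_le[of "\<lambda>n. \<bar>\<tau>\<bar> < 1 - q ^ n" m]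
            by (auto simp: n_def)
          then have "n \<noteq> 0" by (intro notI) auto
          then obtain k where k: "n = Suc k" by (cases n) auto
          have "1 - q ^ k \<le> \<bar>\<tau>\<bar>"
            using not_less_Least[of k "\<lambda>n. \<bar>\<tau>\<bar> < 1 - q ^ n"] k by (auto simp: n_def)
          moreover have "q ^ Suc k = q ^ k - q ^ k * \<delta> / 2" by (simp add: q_def algebra_simps)
          ultimately have \<tau>k: "0 \<le> \<bar>\<tau>\<bar> - (1 - q ^ k)" "\<bar>\<tau>\<bar> - (1 - q ^ k) \<le> q ^ k / 2 * \<delta>"
            using n(1) by (auto simp: k)
          \<comment> \<open>The displacement along \<open>\<sigma>\<close>, in units of
            \<open>R\<close>, that carries the value at \<open>X e k\<close> exactly to
            \<open>a \<bullet> x\<close>. The gap to cover is at most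
            \<open>q ^ k / 2 * \<delta>\<close>, so transversality gives
            \<open>\<bar>u\<bar> \<le> q ^ k / 2\<close>.\<close>
          define u where "u = e * (\<bar>\<tau>\<bar> - (1 - q ^ k)) * l1 a / (a \<bullet> \<sigma>)"
          have "0 < \<delta> * l1 a" using \<delta> L by simp
          then have nz: "a \<bullet> \<sigma> \<noteq> 0" using a(3) by auto
          have "\<bar>u\<bar> * (\<delta> * l1 a) \<le> \<bar>u\<bar> * \<bar>a \<bullet> \<sigma>\<bar>" using a(3) by (intro mult_left_mono) auto
          also have "\<dots> = (\<bar>\<tau>\<bar> - (1 - q ^ k)) * l1 a"
            using nz e(3) L \<tau>k by (simp add: u_def abs_mult)
          also have "\<dots> \<le> (q ^ k / 2 * \<delta>) * l1 a" using \<tau>k L by (intro mult_right_mono) auto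
          finally have "\<bar>u\<bar> * (\<delta> * l1 a) \<le> (q ^ k / 2) * (\<delta> * l1 a)" by (simp add: mult_ac)
          then have u: "\<bar>u\<bar> \<le> q ^ k / 2" using \<open>0 < \<delta> * l1 a\<close> by (rule mult_right_le_imp_le)
          \<comment> \<open>The rounding error is absorbed by the radius \<open>R * r\<close>, since
            \<open>\<bar>a \<bullet> \<sigma>\<bar> \<le> l1 a\<close>.\<close>
          obtain j :: int where j: "\<bar>j * r\<bar> \<le> \<bar>u\<bar>" "\<bar>u - j * r\<bar> \<le> r"
            using round_toward_zero[OF r(1)] by blast
          define c' where "c' = X e k + (R * (j * r)) *\<^sub>R \<sigma>"
          have "(c', R * r) \<in> C1"
            using e(1) n(2) k j(1) u unfolding C1_def c'_def by fastforce
          moreover have "a \<bullet> x - a \<bullet> c' = R * (u - j * r) * (a \<bullet> \<sigma>)"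
          proof -
            have "a \<bullet> x - a \<bullet> c' = e * (\<bar>\<tau>\<bar> - (1 - q ^ k)) * (R * l1 a) - (R * (j * r)) * (a \<bullet> \<sigma>)"
              unfolding c'_def inner_add_right aX ax by (subst e(2)) (simp add: algebra_simps)
            moreover have "e * (\<bar>\<tau>\<bar> - (1 - q ^ k)) * (R * l1 a) = R * (u * (a \<bullet> \<sigma>))"
              using nz by (simp add: u_def)
            ultimately show ?thesis by (simp add: algebra_simps)
          qed
          moreover have "\<bar>R * (u - j * r) * (a \<bullet> \<sigma>)\<bar> \<le> (R * r) * l1 a"
          proof -
            have "\<bar>u - j * r\<bar> * \<bar>a \<bullet> \<sigma>\<bar> \<le> r * l1 a" using j(2) a\<sigma> r by (intro mult_mono) auto
            then show ?thesis using R by (simp add: abs_mult mult.assoc)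
          qed
          ultimately show ?thesis using R r by (intro exI[of _ c'] exI[of _ "R * r"]) auto
        qed
        then obtain c' r' y where "(c', r') \<in> C1 \<union> C2" "y \<in> cube c' r'" "a \<bullet> y = a \<bullet> x"
          using inner_range_cube by metis
        then show "\<exists>y\<in>cubes (C1 \<union> C2). a \<bullet> y = a \<bullet> x"
          unfolding cubes_def by blast
      qed
    qed
  qed
qed

subsection \<open>Sums of sets\<close>

lemma compact_set_plus:
  fixes S T :: "'a::real_normed_vector set"
  assumes "compact S" "compact T"
  shows "compact (S + T)"
proof -
  have "S + T = (\<Union>x\<in>S. \<Union>y\<in>T. {x + y})" by (auto simp: set_plus_def)
  with compact_sums'[OF assms] show ?thesis by simp
qed

lemma compact_sum_sets:
  fixes S :: "'i \<Rightarrow> 'a::real_normed_vector set"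
  assumes "\<And>i. i \<in> I \<Longrightarrow> compact (S i)"
  shows "compact (\<Sum>i\<in>I. S i)"
  using assms by (induction I rule: infinite_finite_induct) (auto intro: compact_set_plus)

lemma countable_sum_sets:
  fixes S :: "'i \<Rightarrow> 'a::comm_monoid_add set"
  assumes "\<And>i. i \<in> I \<Longrightarrow> countable (S i)"
  shows "countable (\<Sum>i\<in>I. S i)"
  using assms by (induction I rule: infinite_finite_induct) (auto simp: set_plus_image)

lemma closed_compact_plus_line:
  fixes F :: "'a::euclidean_space set"
  assumes "compact F"
  shows "closed (F + range (\<lambda>u. u *\<^sub>R \<sigma>))"
proof -
  have "closed (\<Union>x\<in>F. \<Union>y\<in>span {\<sigma>}. {x + y})"
    using assms by (intro compact_closed_sums closed_span)
  moreover have "(\<Union>x\<in>F. \<Union>y\<in>span {\<sigma>}. {x + y}) = F + range (\<lambda>u. u *\<^sub>R \<sigma>)"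
    by (auto simp: set_plus_def span_singleton)
  ultimately show ?thesis by simp
qed

text \<open>In dimension at least two a line is a null set, and so are countably many translates of
  it. This is why the sets \<open>F\<close> are kept countable.\<close>

lemma negligible_countable_plus_line:
  fixes F :: "'a::euclidean_space set"
  assumes "countable F" "2 \<le> DIM('a)"
  shows "negligible (F + range (\<lambda>u. u *\<^sub>R \<sigma>))"
proof -
  have "dim (span {\<sigma>}) \<le> 1" by simp
  then have "negligible (span {\<sigma>})" using assms(2) by (intro negligible_lowdim) linarith
  then have "negligible (\<Union>f\<in>F. (+) f ` span {\<sigma>})"
    using assms(1) by (intro negligible_countable_Union countable_image) (auto intro: negligible_translation)
  moreover have "(\<Union>f\<in>F. (+) f ` span {\<sigma>}) = F + range (\<lambda>u. u *\<^sub>R \<sigma>)"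
    by (auto simp: set_plus_def span_singleton)
  ultimately show ?thesis by simp
qed

text \<open>Displacements along a shared \<open>\<sigma>\<close> add up to a single one, so the sum
  of the tubes stays near parallel lines instead of filling higher-dimensional sets. The errors add
  up to \<open>card I * \<epsilon>\<close>.\<close>

lemma sum_tubes_subset:
  fixes F :: "'i \<Rightarrow> 'a::real_normed_vector set" and \<epsilon> :: real
  assumes "finite I" "I \<noteq> {}" "\<And>i. i \<in> I \<Longrightarrow> S i \<subseteq> tube \<epsilon> (F i) \<sigma>" "x \<in> (\<Sum>i\<in>I. S i)"
  shows "\<exists>y \<in> (\<Sum>i\<in>I. F i) + range (\<lambda>u. u *\<^sub>R \<sigma>). dist x y < card I * \<epsilon>"
proof -
  obtain s where s: "\<And>i. i \<in> I \<Longrightarrow> s i \<in> S i" "x = sum s I"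
    using assms(4) by (auto simp: set_sum_alt[OF \<open>finite I\<close>])
  have "\<forall>i\<in>I. \<exists>f u. f \<in> F i \<and> dist (s i) (f + u *\<^sub>R \<sigma>) < \<epsilon>"
    using s(1) assms(3) by (fastforce simp: tube_def)
  then obtain f u where fu: "\<And>i. i \<in> I \<Longrightarrow> f i \<in> F i"
    "\<And>i. i \<in> I \<Longrightarrow> dist (s i) (f i + u i *\<^sub>R \<sigma>) < \<epsilon>" by metis
  define y where "y = sum f I + (sum u I) *\<^sub>R \<sigma>"
  have "sum f I \<in> (\<Sum>i\<in>I. F i)" using fu(1) by (auto simp: set_sum_alt[OF \<open>finite I\<close>])
  then have "y \<in> (\<Sum>i\<in>I. F i) + range (\<lambda>u. u *\<^sub>R \<sigma>)"
    by (auto simp: y_def intro: set_plus_intro)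
  moreover have "dist x y < card I * \<epsilon>"
  proof -
    have "x - y = (\<Sum>i\<in>I. s i - (f i + u i *\<^sub>R \<sigma>))"
      by (simp add: s y_def sum_subtractf sum.distrib scaleR_sum_left)
    then have "dist x y \<le> (\<Sum>i\<in>I. dist (s i) (f i + u i *\<^sub>R \<sigma>))"
      by (simp add: dist_norm norm_sum)
    also have "\<dots> < (\<Sum>i\<in>I. \<epsilon>)"
      using assms fu by (intro sum_strict_mono) auto
    finally show ?thesis by simp
  qed
  ultimately show ?thesis by blast
qed

subsection \<open>Refinements\<close>

definition refinement ::
    "(real ^ 'd::finite) set \<Rightarrow> ((real ^ 'd) \<times> real) set \<Rightarrow> ((real ^ 'd) \<times> real) set \<Rightarrow> bool" where
  "refinement N C C' \<longleftrightarrow> valid C' \<and> cubes C' \<subseteq> cubes C \<and> shadow_subset N (cubes C) (cubes C')"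

text \<open>\<open>F\<close> is chosen before \<open>\<epsilon>\<close>: the point to be avoided is
  found from \<open>F\<close> alone, and only its distance to the lines determines
  \<open>\<epsilon>\<close>.\<close>

definition refinable_along :: "real ^ 'd::finite \<Rightarrow> (real ^ 'd) set \<Rightarrow> bool" where
  "refinable_along \<sigma> N \<longleftrightarrow> (\<forall>C. valid C \<longrightarrow> (\<exists>F. countable F \<and> compact F \<and>
     (\<forall>\<epsilon>>0. \<exists>C'. refinement N C C' \<and> cubes C' \<subseteq> tube \<epsilon> F \<sigma>)))"

lemma shadow_subset_refl: "shadow_subset N D D"
  by (auto simp: shadow_subset_def)

lemma shadow_subset_trans:
  "shadow_subset N D E \<Longrightarrow> shadow_subset N E F \<Longrightarrow> shadow_subset N D F"
  unfolding shadow_subset_def by metis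

lemma refinement_refl: "valid C \<Longrightarrow> refinement N C C"
  by (simp add: refinement_def shadow_subset_refl)

lemma compact_cubes: "valid C \<Longrightarrow> compact (cubes C)"
  unfolding valid_def cubes_def by (intro compact_UN) (auto simp: compact_cube)

text \<open>\<open>refine_cube\<close> is applied to each of the finitely many cubes; countability,
  compactness and shadows survive the finite union.\<close>

lemma refinable_alongI:
  fixes s \<sigma> :: "real ^ 'd::finite"
  assumes s: "\<And>j. \<bar>s $ j\<bar> \<le> 1" and \<sigma>: "\<And>j. \<bar>\<sigma> $ j\<bar> \<le> 1"
    and \<delta>: "0 < \<delta>" "\<delta> \<le> 1"
    and N: "\<And>a. a \<in> N \<Longrightarrow> a \<noteq> 0 \<and> a \<bullet> s = l1 a \<and> \<delta> * l1 a \<le> \<bar>a \<bullet> \<sigma>\<bar>"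
  shows "refinable_along \<sigma> N"
  unfolding refinable_along_def
proof (intro allI impI)
  fix C :: "((real ^ 'd) \<times> real) set" assume C: "valid C"
  have "\<forall>p\<in>C. \<exists>F. countable F \<and> compact F \<and> (\<forall>\<epsilon>>0. \<exists>C'. valid C' \<and>
      cubes C' \<subseteq> cube (fst p) (snd p) \<and> cubes C' \<subseteq> tube \<epsilon> F \<sigma> \<and>
      shadow_subset N (cube (fst p) (snd p)) (cubes C'))"
  proof
    fix p assume "p \<in> C"
    then have "0 < snd p" using C by (auto simp: valid_def)
    from refine_cube[OF s \<sigma> \<delta> this N] show "\<exists>F. countable F \<and> compact F \<and> (\<forall>\<epsilon>>0. \<exists>C'. valid C' \<and>
      cubes C' \<subseteq> cube (fst p) (snd p) \<and> cubes C' \<subseteq> tube \<epsilon> F \<sigma> \<and>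
      shadow_subset N (cube (fst p) (snd p)) (cubes C'))" .
  qed
  then obtain F where F: "\<And>p. p \<in> C \<Longrightarrow> countable (F p)" "\<And>p. p \<in> C \<Longrightarrow> compact (F p)" and
    *: "\<And>p \<epsilon>. p \<in> C \<Longrightarrow> 0 < \<epsilon> \<Longrightarrow> \<exists>C'. valid C' \<and>
      cubes C' \<subseteq> cube (fst p) (snd p) \<and> cubes C' \<subseteq> tube \<epsilon> (F p) \<sigma> \<and>
      shadow_subset N (cube (fst p) (snd p)) (cubes C')"
    by metis
  have "finite C" using C by (simp add: valid_def)
  show "\<exists>F. countable F \<and> compact F \<and>
     (\<forall>\<epsilon>>0. \<exists>C'. refinement N C C' \<and> cubes C' \<subseteq> tube \<epsilon> F \<sigma>)"
  proof (intro exI[of _ "\<Union>p\<in>C. F p"] conjI allI impI)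
    show "countable (\<Union>p\<in>C. F p)" using F \<open>finite C\<close> by (auto intro: countable_finite)
    show "compact (\<Union>p\<in>C. F p)" using F \<open>finite C\<close> by (auto intro: compact_UN)
    fix \<epsilon> :: real assume "0 < \<epsilon>"
    then have "\<forall>p\<in>C. \<exists>D. valid D \<and>
      cubes D \<subseteq> cube (fst p) (snd p) \<and> cubes D \<subseteq> tube \<epsilon> (F p) \<sigma> \<and>
      shadow_subset N (cube (fst p) (snd p)) (cubes D)"
      using * by blast
    then obtain D where D: "\<And>p. p \<in> C \<Longrightarrow> valid (D p)"
      "\<And>p. p \<in> C \<Longrightarrow> cubes (D p) \<subseteq> cube (fst p) (snd p)"
      "\<And>p. p \<in> C \<Longrightarrow> cubes (D p) \<subseteq> tube \<epsilon> (F p) \<sigma>"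
      "\<And>p. p \<in> C \<Longrightarrow> shadow_subset N (cube (fst p) (snd p)) (cubes (D p))"
      by metis
    have eq: "cubes (\<Union>p\<in>C. D p) = (\<Union>p\<in>C. cubes (D p))" by (simp add: cubes_def)
    have eqC: "cubes C = (\<Union>p\<in>C. cube (fst p) (snd p))" by (simp add: cubes_def case_prod_beta)
    have "valid (\<Union>p\<in>C. D p)" using D(1) \<open>finite C\<close> by (auto simp: valid_def)
    moreover have "cubes (\<Union>p\<in>C. D p) \<subseteq> cubes C" unfolding eq eqC using D(2) by blast
    moreover have "shadow_subset N (cubes C) (cubes (\<Union>p\<in>C. D p))"
      unfolding eq eqC shadow_subset_def
    proof (intro ballI)
      fix a x assume "a \<in> N" "x \<in> (\<Union>p\<in>C. cube (fst p) (snd p))"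
      then obtain p where p: "p \<in> C" "x \<in> cube (fst p) (snd p)" by blast
      then show "\<exists>y\<in>\<Union>p\<in>C. cubes (D p). a \<bullet> y = a \<bullet> x"
        using D(4)[OF p(1)] \<open>a \<in> N\<close> unfolding shadow_subset_def by blast
    qed
    ultimately have "refinement N C (\<Union>p\<in>C. D p)" by (simp add: refinement_def)
    moreover have "cubes (\<Union>p\<in>C. D p) \<subseteq> tube \<epsilon> (\<Union>p\<in>C. F p) \<sigma>"
    proof
      fix x assume "x \<in> cubes (\<Union>p\<in>C. D p)"
      then obtain p where "p \<in> C" "x \<in> tube \<epsilon> (F p) \<sigma>" unfolding eq using D(3) by blast
      then show "x \<in> tube \<epsilon> (\<Union>p\<in>C. F p) \<sigma>" unfolding tube_def by blast
    qed
    ultimately show "\<exists>C'. refinement N C C' \<and> cubes C' \<subseteq> tube \<epsilon> (\<Union>p\<in>C. F p) \<sigma>" by blast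
  qed
qed

text \<open>The limiting set \<open>G\<close> of parallel lines is null by countability and closed
  by compactness, so some ball centred in \<open>B\<close> misses it. Tubes of radius
  \<open>e / n\<close> then keep the sum away from the centre of that ball.\<close>

lemma refine_avoiding_point:
  fixes C :: "'i \<Rightarrow> ((real ^ 'd::finite) \<times> real) set" and \<tau> :: "nat \<Rightarrow> 'i"
  assumes d: "2 \<le> CARD('d)" and "0 < n"
    and C: "\<And>i. i \<in> I \<Longrightarrow> valid (C i)" and \<tau>: "\<And>k. k < n \<Longrightarrow> \<tau> k \<in> I"
    and N: "\<And>k. k < n \<Longrightarrow> refinable_along \<sigma> (N (\<tau> k))"
    and B: "open B" "B \<noteq> {}"
  shows "\<exists>C'. (\<forall>i\<in>I. refinement (N i) (C i) (C' i)) \<and> \<not> B \<subseteq> (\<Sum>k<n. cubes (C' (\<tau> k)))"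
proof -
  have "\<forall>i\<in>\<tau> ` {..<n}. \<exists>F. countable F \<and> compact F \<and>
     (\<forall>\<epsilon>>0. \<exists>C'. refinement (N i) (C i) C' \<and> cubes C' \<subseteq> tube \<epsilon> F \<sigma>)"
    using C N \<tau> by (auto simp: refinable_along_def)
  then obtain F where F: "\<And>i. i \<in> \<tau> ` {..<n} \<Longrightarrow> countable (F i)"
      "\<And>i. i \<in> \<tau> ` {..<n} \<Longrightarrow> compact (F i)"
      "\<And>i \<epsilon>. i \<in> \<tau> ` {..<n} \<Longrightarrow> 0 < \<epsilon> \<Longrightarrow>
         \<exists>C'. refinement (N i) (C i) C' \<and> cubes C' \<subseteq> tube \<epsilon> (F i) \<sigma>"
    by metis
  define G where "G = (\<Sum>k<n. F (\<tau> k)) + range (\<lambda>u. u *\<^sub>R \<sigma>)"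
  have "closed G" unfolding G_def
    using F by (intro closed_compact_plus_line compact_sum_sets) auto
  have "negligible G" unfolding G_def
    using F d by (intro negligible_countable_plus_line countable_sum_sets) auto
  then have "\<not> B \<subseteq> G" using B negligible_subset open_not_negligible by blast
  then obtain y where y: "y \<in> B" "y \<in> - G" by auto
  obtain e where e: "0 < e" "ball y e \<subseteq> - G"
    using y(2) \<open>closed G\<close> by (metis open_Compl openE)
  define \<epsilon> where "\<epsilon> = e / n"
  have "0 < \<epsilon>" using e(1) \<open>0 < n\<close> by (simp add: \<epsilon>_def)
  then have "\<forall>i\<in>\<tau> ` {..<n}. \<exists>D. refinement (N i) (C i) D \<and> cubes D \<subseteq> tube \<epsilon> (F i) \<sigma>"
    using F(3) by blast
  then obtain D where D: "\<And>i. i \<in> \<tau> ` {..<n} \<Longrightarrow> refinement (N i) (C i) (D i)"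
    "\<And>i. i \<in> \<tau> ` {..<n} \<Longrightarrow> cubes (D i) \<subseteq> tube \<epsilon> (F i) \<sigma>"
    by metis
  \<comment> \<open>Refinement is per class and not per position: \<open>\<tau>\<close> may repeat a
    class, and classes outside its image stay unchanged.\<close>
  define C' where "C' i = (if i \<in> \<tau> ` {..<n} then D i else C i)" for i
  have "\<forall>i\<in>I. refinement (N i) (C i) (C' i)"
    using D(1) C by (auto simp: C'_def refinement_refl)
  moreover have "y \<notin> (\<Sum>k<n. cubes (C' (\<tau> k)))"
  proof
    assume y: "y \<in> (\<Sum>k<n. cubes (C' (\<tau> k)))"
    have "\<exists>z \<in> (\<Sum>k<n. F (\<tau> k)) + range (\<lambda>u. u *\<^sub>R \<sigma>). dist y z < card {..<n} * \<epsilon>"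
      using D(2) \<open>0 < n\<close> by (intro sum_tubes_subset[OF _ _ _ y]) (auto simp: C'_def)
    then obtain z where "z \<in> G" "dist y z < e"
      using \<open>0 < n\<close> by (auto simp: G_def \<epsilon>_def)
    then show False using e(2) by auto
  qed
  ultimately show ?thesis using y(1) by blast
qed

text \<open>All pairs of a tuple of classes and a nonempty basic open set are treated one after the
  other, each by one refinement. Later refinements only shrink the sums, so a point once removed
  stays removed, and compactness passes the shadows to the limit.\<close>

lemma thin_families_exist:
  fixes C0 :: "((real ^ 'd::finite) \<times> real) set" and N :: "'i \<Rightarrow> (real ^ 'd) set" and n :: nat
  assumes d: "2 \<le> CARD('d)" and "0 < n" and "finite I" and "valid C0"
    and N: "\<And>\<tau>. \<tau> \<in> {..<n} \<rightarrow> I \<Longrightarrow> \<exists>\<sigma>. \<forall>k<n. refinable_along \<sigma> (N (\<tau> k))"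
  shows "\<exists>K. (\<forall>i\<in>I. compact (K i) \<and> K i \<subseteq> cubes C0 \<and> shadow_subset (N i) (cubes C0) (K i)) \<and>
    (\<forall>\<tau>\<in>{..<n} \<rightarrow> I. interior (\<Sum>k<n. K (\<tau> k)) = {})"
\<comment> \<open>Without classes there are no tuples, as \<open>0 < n\<close>, and the set
  enumerated below would be empty.\<close>
proof (cases "I = {}")
  case True
  show ?thesis by (intro exI[of _ "\<lambda>_. {}"]) (use True \<open>0 < n\<close> in \<open>auto simp: Pi_iff\<close>)
next
  case False
  obtain \<B> :: "(real ^ 'd) set set" where \<B>: "countable \<B>" "topological_basis \<B>"
    using ex_countable_basis by blast
  \<comment> \<open>Extensional functions make the set of tuples finite, hence \<open>T\<close>
    countable.\<close>
  define T where "T = ({..<n} \<rightarrow>\<^sub>E I) \<times> (\<B> - {{}})"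
  have "countable T" unfolding T_def
    using \<B>(1) \<open>finite I\<close> by (intro countable_SIGMA countable_finite[OF finite_PiE]) auto
  have "T \<noteq> {}"
  proof -
    obtain B where "B \<in> \<B>" "0 \<in> B"
      by (rule topological_basisE[OF \<B>(2) open_UNIV UNIV_I])
    moreover have "({..<n} \<rightarrow>\<^sub>E I) \<noteq> {}" using False by (simp add: PiE_eq_empty_iff)
    ultimately show ?thesis by (auto simp: T_def)
  qed
  define t where "t = from_nat_into T"
  have t: "fst (t m) \<in> {..<n} \<rightarrow>\<^sub>E I" "snd (t m) \<in> \<B>" "snd (t m) \<noteq> {}" for m
    using from_nat_into[OF \<open>T \<noteq> {}\<close>, of m] by (auto simp: t_def T_def mem_Times_iff)
  have t_surj: "\<exists>m. t m = p" if "p \<in> T" for p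
    using from_nat_into_surj[OF \<open>countable T\<close> that] unfolding t_def by blast
  \<comment> \<open>The starting value is put into the invariant because dependent choice fixes a
    sequence only through its invariant and its step relation.\<close>
  have "\<exists>C. \<forall>m. ((\<forall>i\<in>I. valid (C m i)) \<and> (m = 0 \<longrightarrow> C m = (\<lambda>_. C0))) \<and>
     ((\<forall>i\<in>I. refinement (N i) (C m i) (C (Suc m) i)) \<and>
      \<not> snd (t m) \<subseteq> (\<Sum>k<n. cubes (C (Suc m) (fst (t m) k))))"
  proof (rule dependent_nat_choice)
    show "\<exists>C. (\<forall>i\<in>I. valid (C i)) \<and> ((0::nat) = 0 \<longrightarrow> C = (\<lambda>_. C0))"
      using \<open>valid C0\<close> by auto
  next
    fix C :: "'i \<Rightarrow> ((real ^ 'd) \<times> real) set" and m :: nat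
    assume C: "(\<forall>i\<in>I. valid (C i)) \<and> (m = 0 \<longrightarrow> C = (\<lambda>_. C0))"
    have \<tau>: "fst (t m) \<in> {..<n} \<rightarrow> I" using t(1)[of m] by (auto simp: PiE_iff)
    obtain \<sigma> where "\<forall>k<n. refinable_along \<sigma> (N (fst (t m) k))" using N[OF \<tau>] by blast
    moreover have "open (snd (t m))" using t(2) \<B>(2) by (rule topological_basis_open[rotated])
    ultimately have "\<exists>C'. (\<forall>i\<in>I. refinement (N i) (C i) (C' i)) \<and>
        \<not> snd (t m) \<subseteq> (\<Sum>k<n. cubes (C' (fst (t m) k)))"
      using C \<tau> t(3) by (intro refine_avoiding_point[OF d \<open>0 < n\<close>]) auto
    then show "\<exists>C'. ((\<forall>i\<in>I. valid (C' i)) \<and> (Suc m = 0 \<longrightarrow> C' = (\<lambda>_. C0))) \<and>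
       ((\<forall>i\<in>I. refinement (N i) (C i) (C' i)) \<and>
        \<not> snd (t m) \<subseteq> (\<Sum>k<n. cubes (C' (fst (t m) k))))"
      by (auto simp: refinement_def)
  qed
  then obtain C where C: "\<And>m i. i \<in> I \<Longrightarrow> valid (C m i)" "C 0 = (\<lambda>_. C0)"
    and ref: "\<And>m i. i \<in> I \<Longrightarrow> refinement (N i) (C m i) (C (Suc m) i)"
    and miss: "\<And>m. \<not> snd (t m) \<subseteq> (\<Sum>k<n. cubes (C (Suc m) (fst (t m) k)))"
    by blast
  define K where "K i = (\<Inter>m. cubes (C m i))" for i
  have comp: "compact (cubes (C m i))" if "i \<in> I" for m i
    using C(1)[OF that] by (rule compact_cubes)
  have K: "compact (K i)" if "i \<in> I" for i
    unfolding K_def using comp[OF that] by (intro compact_Inter) auto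
  have anti: "cubes (C m' i) \<subseteq> cubes (C m i)" if "i \<in> I" "m \<le> m'" for i m m'
    using that(2) by (rule lift_Suc_antimono_le[rotated]) (use ref[OF that(1)] in \<open>auto simp: refinement_def\<close>)
  show ?thesis
  proof (intro exI[of _ K] conjI ballI)
    show "compact (K i)" if "i \<in> I" for i by (rule K[OF that])
    show "K i \<subseteq> cubes C0" for i using C(2) unfolding K_def by (metis INF_lower UNIV_I)
    show "shadow_subset (N i) (cubes C0) (K i)" if i: "i \<in> I" for i
      unfolding shadow_subset_def
    proof (intro ballI)
      fix a x assume a: "a \<in> N i" and x: "x \<in> cubes C0"
      have sh: "shadow_subset (N i) (cubes C0) (cubes (C m i))" for m
        using ref[OF i]
        by (induction m) (auto simp: C(2) shadow_subset_refl refinement_def intro: shadow_subset_trans)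
      \<comment> \<open>The slices of the stages by the given hyperplane are nested, compact and
        nonempty, so they share a point, which lies in \<open>K i\<close>.\<close>
      define H where "H m = cubes (C m i) \<inter> {y. a \<bullet> y = a \<bullet> x}" for m
      have "\<Inter>(range H) \<noteq> {}"
      proof (rule compact_nest)
        show "compact (H m)" for m unfolding H_def
          using comp[OF i] by (intro compact_Int_closed closed_hyperplane)
        show "H m \<noteq> {}" for m using sh[of m] a x by (auto simp: H_def shadow_subset_def)
        show "H m' \<subseteq> H m" if "m \<le> m'" for m m' using anti[OF i that] by (auto simp: H_def)
      qed
      then show "\<exists>y\<in>K i. a \<bullet> y = a \<bullet> x" by (auto simp: H_def K_def)
    qed
    fix \<tau> assume \<tau>: "\<tau> \<in> {..<n} \<rightarrow> I"
    define \<tau>' where "\<tau>' = restrict \<tau> {..<n}"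
    show "interior (\<Sum>k<n. K (\<tau> k)) = {}"
    proof (rule ccontr)
      assume "interior (\<Sum>k<n. K (\<tau> k)) \<noteq> {}"
      then obtain z where "z \<in> interior (\<Sum>k<n. K (\<tau> k))" by blast
      then obtain B where B: "B \<in> \<B>" "z \<in> B" "B \<subseteq> interior (\<Sum>k<n. K (\<tau> k))"
        by (rule topological_basisE[OF \<B>(2) open_interior])
      have "(\<tau>', B) \<in> T" using \<tau> B by (auto simp: T_def \<tau>'_def)
      then obtain m where m: "t m = (\<tau>', B)" using t_surj by blast
      \<comment> \<open>The right-hand side was made at stage \<open>m\<close> to miss a point of
        \<open>B\<close>, while \<open>B\<close> lies in the left-hand side.\<close>
      have "(\<Sum>k<n. K (\<tau> k)) \<subseteq> (\<Sum>k<n. cubes (C (Suc m) (\<tau>' k)))"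
        by (auto simp: set_sum_alt K_def \<tau>'_def)
      then show False using miss[of m] B(3) interior_subset unfolding m by auto
    qed
  qed
qed

subsection \<open>Directions in general position\<close>

text \<open>Points of the moment curve: \<open>a \<bullet> v t\<close> is a nonzero polynomial in \<open>t\<close> of degree less than \<open>d\<close>.\<close>
lemma ex_general_position_directions:
  assumes "2 \<le> CARD('d::finite)"
  shows "\<exists>T :: (real ^ 'd) set. finite T \<and> card T = n \<and> (\<forall>\<sigma>\<in>T. \<forall>j. \<bar>\<sigma> $ j\<bar> \<le> 1) \<and>
    (\<forall>a. a \<noteq> 0 \<longrightarrow> card {\<sigma>\<in>T. a \<bullet> \<sigma> = 0} < CARD('d))"
proof -
  obtain h :: "'d \<Rightarrow> nat" where h: "bij_betw h UNIV {0..<CARD('d)}"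
    using ex_bij_betw_finite_nat[of "UNIV :: 'd set"] by auto
  have h_less: "h j < CARD('d)" for j using bij_betwE[OF h] by auto
  have "inj h" using h by (simp add: bij_betw_def)
  \<comment> \<open>The coordinate with exponent 1 recovers \<open>t\<close>, so \<open>v\<close> is
    injective; it exists because the dimension is at least two.\<close>
  have "1 \<in> h ` UNIV" using h assms by (simp add: bij_betw_def)
  then obtain j1 where j1: "h j1 = 1" by force
  define v :: "real \<Rightarrow> real ^ 'd" where "v t = (\<chi> j. t ^ h j)" for t
  have "inj v" by (rule injI) (metis j1 power_one_right v_def vec_lambda_beta)
  \<comment> \<open>Parameters in the interval from 0 to 1 keep all powers, hence all coordinates,
    bounded by 1.\<close>
  define P where "P = (\<lambda>k. inverse (real (Suc k))) ` {..<n}"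
  have "card P = n" unfolding P_def by (subst card_image) (auto simp: inj_on_def)
  have P01: "0 < t" "t \<le> 1" if "t \<in> P" for t
    using that by (auto simp: P_def field_simps)
  show ?thesis
  proof (intro exI[of _ "v ` P"] conjI ballI allI impI)
    show "finite (v ` P)" by (simp add: P_def)
    show "card (v ` P) = n" using \<open>card P = n\<close> \<open>inj v\<close> by (simp add: card_image inj_on_subset)
    show "\<bar>\<sigma> $ j\<bar> \<le> 1" if "\<sigma> \<in> v ` P" for \<sigma> j
    proof -
      from that obtain t where "t \<in> P" "\<sigma> = v t" by blast
      then show ?thesis using P01[of t] by (simp add: v_def power_le_one)
    qed
    fix a :: "real ^ 'd" assume "a \<noteq> 0"
    define p where "p = (\<Sum>j\<in>UNIV. monom (a $ j) (h j))"
    have coeff: "coeff p (h j) = a $ j" for j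
      using \<open>inj h\<close> by (simp add: p_def coeff_sum inj_eq if_distrib cong: if_cong)
    obtain j where "a $ j \<noteq> 0" using \<open>a \<noteq> 0\<close> by (auto simp: vec_eq_iff)
    then have "p \<noteq> 0" using coeff[of j] by auto
    have poly: "poly p t = a \<bullet> v t" for t
      by (simp add: p_def poly_sum poly_monom inner_vec_def v_def)
    have "degree p < CARD('d)"
      unfolding p_def using h_less by (intro degree_sum_less) (auto intro: le_less_trans[OF degree_monom_le])
    have "{\<sigma>\<in>v ` P. a \<bullet> \<sigma> = 0} \<subseteq> v ` {t. poly p t = 0}" by (auto simp: poly)
    moreover have fin: "finite {t. poly p t = 0}" using \<open>p \<noteq> 0\<close> by (rule poly_roots_finite)
    ultimately have "card {\<sigma>\<in>v ` P. a \<bullet> \<sigma> = 0} \<le> card {t. poly p t = 0}"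
      by (meson card_image_le card_mono finite_imageI le_trans)
    also have "\<dots> \<le> degree p" using \<open>p \<noteq> 0\<close> by (rule card_poly_roots_bound)
    finally show "card {\<sigma>\<in>v ` P. a \<bullet> \<sigma> = 0} < CARD('d)" using \<open>degree p < _\<close> by simp
  qed
qed

section \<open>Uniform transversality\<close>

lemma l1_le_norm: "l1 a \<le> CARD('d) * norm (a :: real ^ 'd::finite)"
proof -
  have "l1 a \<le> (\<Sum>j\<in>(UNIV :: 'd set). norm a)"
    unfolding l1_def by (intro sum_mono component_le_norm_cart)
  then show ?thesis by simp
qed

text \<open>For each \<open>m\<close>-element \<open>W\<close> the sum of
  \<open>\<bar>a \<bullet> \<sigma>\<bar>\<close> over \<open>W\<close> vanishes only at
  \<open>a = 0\<close>, so it has a positive minimum on the unit sphere and dominates a multiple of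
  the norm. As there are finitely many \<open>W\<close>, one constant serves all; \<open>m\<close>
  directions nearly orthogonal to \<open>a\<close> would contradict it.\<close>

lemma general_position_uniform:
  fixes T :: "(real ^ 'd::finite) set"
  assumes "finite T" and T: "\<And>a. a \<noteq> 0 \<Longrightarrow> card {\<sigma>\<in>T. a \<bullet> \<sigma> = 0} < m"
  shows "\<exists>\<delta>>0. \<delta> \<le> 1 \<and> (\<forall>a. a \<noteq> 0 \<longrightarrow> card {\<sigma>\<in>T. \<bar>a \<bullet> \<sigma>\<bar> < \<delta> * l1 a} < m)"
proof -
  define \<W> where "\<W> = {W. W \<subseteq> T \<and> card W = m}"
  have "finite \<W>" using \<open>finite T\<close> by (auto simp: \<W>_def)
  have "0 < m" using T[of 1] by simp
  have "\<forall>W\<in>\<W>. \<exists>\<epsilon>>0. \<forall>a. \<epsilon> * norm a \<le> (\<Sum>\<sigma>\<in>W. \<bar>a \<bullet> \<sigma>\<bar>)"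
  proof
    fix W assume W: "W \<in> \<W>"
    have "finite W" using W \<open>finite T\<close> by (auto simp: \<W>_def finite_subset)
    define f where "f a = (\<Sum>\<sigma>\<in>W. \<bar>a \<bullet> \<sigma>\<bar>)" for a
    have pos: "0 < f a" if "a \<noteq> 0" for a
    proof (rule ccontr)
      assume "\<not> 0 < f a"
      moreover have "0 \<le> f a" by (auto simp: f_def intro: sum_nonneg)
      ultimately have "f a = 0" by simp
      then have "W \<subseteq> {\<sigma>\<in>T. a \<bullet> \<sigma> = 0}"
        using W \<open>finite W\<close> by (auto simp: f_def \<W>_def sum_nonneg_eq_0_iff)
      then have "m \<le> card {\<sigma>\<in>T. a \<bullet> \<sigma> = 0}"
        using W \<open>finite T\<close> by (auto simp: \<W>_def intro: card_mono)
      then show False using T[OF that] by simp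
    qed
    have "continuous_on (sphere 0 1) f" unfolding f_def by (intro continuous_intros)
    moreover have "sphere 0 1 \<noteq> ({} :: (real ^ 'd) set)" by simp
    ultimately obtain b where b: "b \<in> sphere 0 1" "\<And>a. a \<in> sphere 0 1 \<Longrightarrow> f b \<le> f a"
      using continuous_attains_inf[OF compact_sphere] by metis
    have "f b * norm a \<le> f a" for a
    proof (cases "a = 0")
      case False
      have "f b * norm a \<le> f ((1 / norm a) *\<^sub>R a) * norm a"
        using False by (intro mult_right_mono b) auto
      also have "\<dots> = f a"
        using False by (simp add: f_def sum_distrib_right abs_mult)
      finally show ?thesis .
    qed (simp add: f_def)
    moreover have "0 < f b" using b(1) by (intro pos) auto
    ultimately show "\<exists>\<epsilon>>0. \<forall>a. \<epsilon> * norm a \<le> (\<Sum>\<sigma>\<in>W. \<bar>a \<bullet> \<sigma>\<bar>)"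
      by (auto simp: f_def)
  qed
  then obtain \<epsilon> where \<epsilon>: "\<And>W. W \<in> \<W> \<Longrightarrow> 0 < \<epsilon> W"
    "\<And>W a. W \<in> \<W> \<Longrightarrow> \<epsilon> W * norm a \<le> (\<Sum>\<sigma>\<in>W. \<bar>a \<bullet> \<sigma>\<bar>)" by metis
  \<comment> \<open>The inserted 1 covers the case without any \<open>m\<close>-element subset and
    gives \<open>\<epsilon>0 \<le> 1\<close>.\<close>
  define \<epsilon>0 where "\<epsilon>0 = Min (insert 1 (\<epsilon> ` \<W>))"
  have "0 < \<epsilon>0" "\<epsilon>0 \<le> 1" using \<open>finite \<W>\<close> \<epsilon>(1) by (auto simp: \<epsilon>0_def)
  have \<epsilon>0_le: "\<epsilon>0 \<le> \<epsilon> W" if "W \<in> \<W>" for W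
    using that \<open>finite \<W>\<close> by (auto simp: \<epsilon>0_def)
  \<comment> \<open>The divisor \<open>m\<close> accounts for the number of summands,
    \<open>CARD('d)\<close> for passing from \<open>l1\<close> to the Euclidean norm.\<close>
  define \<delta> where "\<delta> = \<epsilon>0 / (m * CARD('d))"
  have "1 \<le> m * CARD('d)" using \<open>0 < m\<close> by (simp add: Suc_le_eq)
  from of_nat_mono[OF this] have pos: "1 \<le> real (m * CARD('d))" by (simp only: of_nat_1)
  show ?thesis
  proof (intro exI[of _ \<delta>] conjI allI impI)
    show "0 < \<delta>" using \<open>0 < \<epsilon>0\<close> \<open>0 < m\<close> by (simp add: \<delta>_def)
    show "\<delta> \<le> 1" 
    proof -
      have "\<epsilon>0 / (m * CARD('d)) \<le> 1 / 1"
        using \<open>\<epsilon>0 \<le> 1\<close> \<open>0 < \<epsilon>0\<close> pos by (intro frac_le) auto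
      then show ?thesis by (simp add: \<delta>_def)
    qed
    fix a :: "real ^ 'd" assume "a \<noteq> 0"
    show "card {\<sigma>\<in>T. \<bar>a \<bullet> \<sigma>\<bar> < \<delta> * l1 a} < m"
    proof (rule ccontr)
      assume "\<not> ?thesis"
      then have "m \<le> card {\<sigma>\<in>T. \<bar>a \<bullet> \<sigma>\<bar> < \<delta> * l1 a}" by simp
      then obtain W where W: "W \<subseteq> {\<sigma>\<in>T. \<bar>a \<bullet> \<sigma>\<bar> < \<delta> * l1 a}" "card W = m" "finite W"
        by (rule obtain_subset_with_card_n)
      then have "W \<in> \<W>" by (auto simp: \<W>_def)
      have "\<epsilon>0 * norm a \<le> \<epsilon> W * norm a" using \<epsilon>0_le[OF \<open>W \<in> \<W>\<close>] by (intro mult_right_mono) auto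
      also have "\<dots> \<le> (\<Sum>\<sigma>\<in>W. \<bar>a \<bullet> \<sigma>\<bar>)" by (rule \<epsilon>(2)[OF \<open>W \<in> \<W>\<close>])
      also have "\<dots> < (\<Sum>\<sigma>\<in>W. \<delta> * l1 a)"
        using W \<open>0 < m\<close> by (intro sum_strict_mono) auto
      also have "\<dots> = (m * \<delta>) * l1 a" using W by simp
      also have "\<dots> \<le> (m * \<delta>) * (CARD('d) * norm a)"
        using \<open>0 < \<epsilon>0\<close> by (intro mult_left_mono l1_le_norm) (auto simp: \<delta>_def)
      also have "\<dots> = \<epsilon>0 * norm a" using \<open>0 < m\<close> by (simp add: \<delta>_def)
      finally show False by simp
    qed
  qed
qed

subsection \<open>The compact set\<close>

theorem corollary7p2:
  assumes "CARD('d::finite) \<ge> 2"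
  shows "\<exists>K :: (real ^ 'd) set.
           compact K \<and> K \<subseteq> cbox 0 1 \<and>
           (\<forall>A :: (real ^ 'd) set.
              affine A \<and> aff_dim A = int CARD('d) - 1 \<and> A \<inter> cbox 0 1 \<noteq> {} \<longrightarrow> K \<inter> A \<noteq> {}) \<and>
           nowhere_dense (sumset CARD('d) K)"
proof -
  define d where "d = CARD('d)"
  \<comment> \<open>With \<open>d * d\<close> directions, one survives after each of
    \<open>d\<close> classes has discarded fewer than \<open>d\<close>.\<close>
  obtain T :: "(real ^ 'd) set" where T: "finite T" "card T = d * d"
    "\<And>\<sigma> j. \<sigma> \<in> T \<Longrightarrow> \<bar>\<sigma> $ j\<bar> \<le> 1"
    "\<And>a. a \<noteq> 0 \<Longrightarrow> card {\<sigma>\<in>T. a \<bullet> \<sigma> = 0} < d"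
    using ex_general_position_directions[OF assms, of "d * d"] unfolding d_def by blast
  obtain \<delta> where \<delta>: "0 < \<delta>" "\<delta> \<le> 1"
    "\<And>a. a \<noteq> 0 \<Longrightarrow> card {\<sigma>\<in>T. \<bar>a \<bullet> \<sigma>\<bar> < \<delta> * l1 a} < d"
    using general_position_uniform[OF T(1,4)] by blast
  define sg :: "'d set \<Rightarrow> real ^ 'd" where "sg J = (\<chi> j. if j \<in> J then 1 else - 1)" for J
  define I where "I = (UNIV :: 'd set set) \<times> {S. S \<subseteq> T \<and> card (T - S) < d}"
  \<comment> \<open>\<open>a \<bullet> sg J = l1 a\<close> says that \<open>J\<close> contains all
    positive coordinates of \<open>a\<close> and no negative one; zero coordinates are free. The
    classes may overlap, as only covering matters.\<close>
  define N where "N = (\<lambda>(J, S). {a. a \<noteq> 0 \<and> a \<bullet> sg J = l1 a \<and> (\<forall>\<sigma>\<in>S. \<delta> * l1 a \<le> \<bar>a \<bullet> \<sigma>\<bar>)})"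
  have "finite I" using T(1) by (auto simp: I_def)
  have "0 < d" by (simp add: d_def)
  have N_cover: "\<exists>i\<in>I. a \<in> N i" if "a \<noteq> 0" for a
  proof
    define S where "S = {\<sigma>\<in>T. \<delta> * l1 a \<le> \<bar>a \<bullet> \<sigma>\<bar>}"
    have "T - S = {\<sigma>\<in>T. \<bar>a \<bullet> \<sigma>\<bar> < \<delta> * l1 a}" by (auto simp: S_def)
    then show "({j. 0 \<le> a $ j}, S) \<in> I" using \<delta>(3)[OF that] by (auto simp: I_def S_def)
    have "a \<bullet> sg {j. 0 \<le> a $ j} = l1 a"
      by (auto simp: l1_def sg_def inner_vec_def intro!: sum.cong)
    then show "a \<in> N ({j. 0 \<le> a $ j}, S)" using that by (simp add: N_def S_def)
  qed
  have common: "\<exists>\<sigma>. \<forall>k<d. refinable_along \<sigma> (N (\<tau> k))" if \<tau>: "\<tau> \<in> {..<d} \<rightarrow> I" for \<tau>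
  proof -
    have card: "card (T - snd (\<tau> k)) < d" if "k < d" for k
      using \<tau> that by (auto simp: I_def Pi_iff mem_Times_iff)
    have "card (\<Union>k<d. T - snd (\<tau> k)) \<le> (\<Sum>k<d. card (T - snd (\<tau> k)))"
      by (rule card_UN_le) simp
    also have "\<dots> < (\<Sum>k<d. d)" using card \<open>0 < d\<close> by (intro sum_strict_mono) auto
    finally have "card (\<Union>k<d. T - snd (\<tau> k)) < card T" using T(2) by simp
    then have "(\<Union>k<d. T - snd (\<tau> k)) \<noteq> T" by auto
    then obtain \<sigma> where \<sigma>: "\<sigma> \<in> T" "\<And>k. k < d \<Longrightarrow> \<sigma> \<in> snd (\<tau> k)" by blast
    have "refinable_along \<sigma> (N (\<tau> k))" if "k < d" for k
    proof (rule refinable_alongI[OF _ T(3)[OF \<sigma>(1)] \<delta>(1,2)])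
      show "\<bar>sg (fst (\<tau> k)) $ j\<bar> \<le> 1" for j by (simp add: sg_def)
      show "a \<noteq> 0 \<and> a \<bullet> sg (fst (\<tau> k)) = l1 a \<and> \<delta> * l1 a \<le> \<bar>a \<bullet> \<sigma>\<bar>" if "a \<in> N (\<tau> k)" for a
        using that \<sigma>(2)[OF \<open>k < d\<close>] by (auto simp: N_def split: prod.splits)
    qed
    then show ?thesis by blast
  qed
  define C0 :: "((real ^ 'd) \<times> real) set" where "C0 = {(\<chi> j. 1 / 2, 1 / 2)}"
  have "valid C0" by (simp add: C0_def valid_def)
  have C0: "cubes C0 = cbox 0 1"
  proof -
    have "(\<chi> j. 1 / 2) - (1 / 2) *\<^sub>R 1 = (0 :: real ^ 'd)" "(\<chi> j. 1 / 2) + (1 / 2) *\<^sub>R 1 = (1 :: real ^ 'd)"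
      by (simp_all add: vec_eq_iff)
    then show ?thesis by (simp add: cubes_def C0_def cube_eq_cbox)
  qed
  from thin_families_exist[OF assms \<open>0 < d\<close> \<open>finite I\<close> \<open>valid C0\<close> common]
  obtain L where "(\<forall>i\<in>I. compact (L i) \<and> L i \<subseteq> cbox 0 1 \<and> shadow_subset (N i) (cbox 0 1) (L i)) \<and>
    (\<forall>\<tau>\<in>{..<d} \<rightarrow> I. interior (\<Sum>k<d. L (\<tau> k)) = {})"
    unfolding C0 ..
  then have L: "\<And>i. i \<in> I \<Longrightarrow> compact (L i)" "\<And>i. i \<in> I \<Longrightarrow> L i \<subseteq> cbox 0 1"
    "\<And>i. i \<in> I \<Longrightarrow> shadow_subset (N i) (cbox 0 1) (L i)"
    "\<And>\<tau>. \<tau> \<in> {..<d} \<rightarrow> I \<Longrightarrow> interior (\<Sum>k<d. L (\<tau> k)) = {}"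
    by simp_all
  define K where "K = (\<Union>i\<in>I. L i)"
  show ?thesis
  proof (intro exI[of _ K] conjI allI impI)
    show "compact K" unfolding K_def using L(1) \<open>finite I\<close> by (intro compact_UN) auto
    show "K \<subseteq> cbox 0 1" using L(2) by (auto simp: K_def)
  next
    fix A :: "(real ^ 'd) set"
    assume A: "affine A \<and> aff_dim A = int CARD('d) - 1 \<and> A \<inter> cbox 0 1 \<noteq> {}"
    \<comment> \<open>Truncated subtraction is harmless here, the dimension being at least
      two.\<close>
    then have "aff_dim A = int (DIM(real ^ 'd) - 1)" using assms by (simp add: of_nat_diff)
    then have "\<exists>a b. a \<noteq> 0 \<and> affine hull A = {x. a \<bullet> x = b}"
      by (rule aff_dim_eq_hyperplane[THEN iffD1])
    then obtain a b where ab: "a \<noteq> 0" "affine hull A = {x. a \<bullet> x = b}"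
      by (elim exE conjE)
    then have A_eq: "A = {x. a \<bullet> x = b}" using A by (simp add: hull_same)
    obtain x where x: "x \<in> cbox 0 1" "a \<bullet> x = b" using A by (auto simp: A_eq)
    obtain i where i: "i \<in> I" "a \<in> N i" using N_cover[OF ab(1)] by blast
    then obtain y where "y \<in> L i" "a \<bullet> y = a \<bullet> x"
      using L(3)[OF i(1)] x(1) by (auto simp: shadow_subset_def)
    then show "K \<inter> A \<noteq> {}" using i(1) x(2) by (auto simp: K_def A_eq)
  next
    define Z where "Z \<tau> = (\<Sum>k<d. L (\<tau> k))" for \<tau>
    have comp: "compact (Z \<tau>)" if "\<tau> \<in> {..<d} \<rightarrow> I" for \<tau>
      unfolding Z_def using that by (intro compact_sum_sets L(1)) (auto simp del: split_paired_All)
    \<comment> \<open>Each summand lies in the set of some class, so the sumset splits over the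
      tuples of classes; extensional tuples keep this union finite.\<close>
    have sub: "sumset d K \<subseteq> (\<Union>\<tau>\<in>{..<d} \<rightarrow>\<^sub>E I. Z \<tau>)"
    proof
      fix z assume "z \<in> sumset d K"
      then obtain x where x: "\<And>k. k < d \<Longrightarrow> x k \<in> K" "z = (\<Sum>k<d. x k)"
        by (auto simp: sumset_def)
      from x(1) have "\<forall>k. \<exists>i. k < d \<longrightarrow> i \<in> I \<and> x k \<in> L i" unfolding K_def by blast
      then obtain \<tau> where \<tau>: "\<And>k. k < d \<Longrightarrow> \<tau> k \<in> I" "\<And>k. k < d \<Longrightarrow> x k \<in> L (\<tau> k)"
        by metis
      then have "z \<in> Z (restrict \<tau> {..<d})" by (auto simp: Z_def set_sum_alt x(2))
      moreover have "restrict \<tau> {..<d} \<in> {..<d} \<rightarrow>\<^sub>E I" using \<tau>(1) by auto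
      ultimately show "z \<in> (\<Union>\<tau>\<in>{..<d} \<rightarrow>\<^sub>E I. Z \<tau>)" by blast
    qed
    \<comment> \<open>A union of two sets with empty interior can have interior points unless one of
      them is closed, so the induction carries closedness along.\<close>
    have thin: "closed (\<Union>\<tau>\<in>\<Theta>. Z \<tau>) \<and> interior (\<Union>\<tau>\<in>\<Theta>. Z \<tau>) = {}"
      if "finite \<Theta>" "\<Theta> \<subseteq> {..<d} \<rightarrow> I" for \<Theta>
      using that
    proof (induction \<Theta> rule: finite_induct)
      case (insert \<tau> \<Theta>)
      then have "closed (Z \<tau>)" "interior (Z \<tau>) = {}"
        using comp L(4) by (auto simp: Z_def compact_imp_closed)
      then show ?case using insert
        by (auto simp: interior_closed_Un_empty_interior)
    qed simp
    have "finite ({..<d} \<rightarrow>\<^sub>E I)" using \<open>finite I\<close> by (intro finite_PiE) auto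
    moreover have "({..<d} \<rightarrow>\<^sub>E I) \<subseteq> {..<d} \<rightarrow> I" by (simp add: PiE_def)
    ultimately have "closed (\<Union>\<tau>\<in>{..<d} \<rightarrow>\<^sub>E I. Z \<tau>)" "interior (\<Union>\<tau>\<in>{..<d} \<rightarrow>\<^sub>E I. Z \<tau>) = {}"
      using thin by simp_all
    then have "interior (closure (sumset d K)) = {}"
      using interior_mono[OF closure_minimal[OF sub]] by simp
    then show "nowhere_dense (sumset CARD('d) K)" by (simp add: nowhere_dense_def d_def)
  qed
qed

end
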